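(* Let $X_1,\ldots,X_s$ be pairwise disjoint finite nonempty sets, $n_i=\#X_i$, $X=\bigcup_{1\le i\le s}X_i$, $n=\#X=\sum_{i} n_i$, and let $f_i\colon X_i\to X_i$ be maps. Let $f\colon X\to X$ be defined by $f(x)=f_i(x)$ for $x\in X_i$. Then for every positive integer $k$, $$H_{f,k}=\sum_{1\le i\le s}\frac{n_i}{n}\,H_{f_i,k}.$$
   Context: For a finite set $Y$ with $m$ elements, a map $g\colon Y\to Y$, $g^{(j)}$ its $j$-th iterate ($g^{(0)}=\mathrm{id}$), a positive integer $k$ and $x,y\in Y$, let $N_{g,k}(x,y)=\#\{j\in\mathbb{N}: 0\le j<k,\ g^{(j)}(x)=y\}$. The (shifted $k$-th) iteration entropy of $g$ is $$H_{g,k}=\frac{1}{km}\sum_{x,y\in Y}N_{g,k}(x,y)\log_2\frac{k}{N_{g,k}(x,y)},$$ with the convention that a summand is $0$ when $N_{g,k}(x,y)=0$. *)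

theory Defs
  imports Complex_Main "HOL-Library.FuncSet" "HOL-Library.Disjoint_Sets"
begin

text \<open>
  A self-map of a finite set \<open>Y\<close> is rendered as a function on the ambient type lying in
  \<open>Y \<rightarrow> Y\<close>; its values outside \<open>Y\<close> play no role.
\<close>

definition visit_count :: "('a \<Rightarrow> 'a) \<Rightarrow> nat \<Rightarrow> 'a \<Rightarrow> 'a \<Rightarrow> nat" where
  "visit_count g k x y = card {j. j < k \<and> (g ^^ j) x = y}"

definition iteration_entropy :: "'a set \<Rightarrow> ('a \<Rightarrow> 'a) \<Rightarrow> nat \<Rightarrow> real" where
  "iteration_entropy Y g k =
     1 / (real k * real (card Y)) *
     (\<Sum>x\<in>Y. \<Sum>y\<in>Y.
        if visit_count g k x y = 0 then 0
        else real (visit_count g k x y) * log 2 (real k / real (visit_count g k x y)))"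

end

theory Submission
  imports Defs
begin

text \<open>
  An orbit that starts in \<open>X i\<close> stays there and is an orbit of \<open>F i\<close>, so pairs of points in
  different blocks contribute nothing to the double sum and pairs within \<open>X i\<close> contribute the
  same to \<open>f\<close> as to \<open>F i\<close>. The double sum is therefore additive over the blocks, and the weights
  \<open>card (X i) / card X\<close> only account for the normalising factors.
\<close>

text \<open>Agreement and invariance are proved in one induction: \<open>f\<close> may be replaced
  by \<open>g\<close> in the next step only because the current iterate is still in
  \<open>A\<close>.\<close>

lemma funpow_cong_on:
  assumes "g \<in> A \<rightarrow> A" and "\<And>x. x \<in> A \<Longrightarrow> f x = g x" and "x \<in> A"
  shows "(f ^^ j) x = (g ^^ j) x \<and> (g ^^ j) x \<in> A"
  using assms by (induction j) (auto simp: Pi_iff)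

lemma visit_count_cong_on:
  assumes "g \<in> A \<rightarrow> A" and "\<And>x. x \<in> A \<Longrightarrow> f x = g x" and "x \<in> A"
  shows "visit_count f k x y = visit_count g k x y"
  using funpow_cong_on[OF assms] by (simp add: visit_count_def)

lemma visit_count_outside:
  assumes "g \<in> A \<rightarrow> A" and "x \<in> A" and "y \<notin> A"
  shows "visit_count g k x y = 0"
proof -
  have "(g ^^ j) x \<noteq> y" for j
    using funpow_cong_on[OF assms(1) refl assms(2)] assms(3) by metis
  then show ?thesis by (simp add: visit_count_def)
qed

text \<open>Naming the summand lets the sums be rearranged without opening the case
  distinction.\<close>

definition entropy_term :: "('a \<Rightarrow> 'a) \<Rightarrow> nat \<Rightarrow> 'a \<Rightarrow> 'a \<Rightarrow> real" where
  "entropy_term g k x y =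
     (if visit_count g k x y = 0 then 0
      else real (visit_count g k x y) * log 2 (real k / real (visit_count g k x y)))"

lemma iteration_entropy_eq:
  "iteration_entropy Y g k =
     1 / (real k * real (card Y)) * (\<Sum>x\<in>Y. \<Sum>y\<in>Y. entropy_term g k x y)"
  unfolding iteration_entropy_def entropy_term_def ..

lemma entropy_term_row_sum:
  assumes "finite B" and "A \<subseteq> B" and "g \<in> A \<rightarrow> A"
    and "\<And>x. x \<in> A \<Longrightarrow> f x = g x" and "x \<in> A"
  shows "(\<Sum>y\<in>B. entropy_term f k x y) = (\<Sum>y\<in>A. entropy_term g k x y)"
proof -
  have "entropy_term f k x y = entropy_term g k x y" for y
    using visit_count_cong_on[OF assms(3,4,5)] by (simp add: entropy_term_def)
  moreover have "entropy_term g k x y = 0" if "y \<notin> A" for y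
    using visit_count_outside[OF assms(3,5) that] by (simp add: entropy_term_def)
  ultimately show ?thesis
    using assms(1,2) by (intro sum.mono_neutral_cong_right) auto
qed

theorem theorem1:
  fixes s k :: nat
    and X :: "nat \<Rightarrow> 'a set"
    and F :: "nat \<Rightarrow> 'a \<Rightarrow> 'a"
    and f :: "'a \<Rightarrow> 'a"
  assumes "s \<ge> 1"
    and "\<And>i. i \<in> {1..s} \<Longrightarrow> finite (X i)"
    and "\<And>i. i \<in> {1..s} \<Longrightarrow> X i \<noteq> {}"
    and "disjoint_family_on X {1..s}"
    and "\<And>i. i \<in> {1..s} \<Longrightarrow> F i \<in> X i \<rightarrow> X i"
    and "\<And>i x. i \<in> {1..s} \<Longrightarrow> x \<in> X i \<Longrightarrow> f x = F i x"
    and "k > 0"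
  shows "iteration_entropy (\<Union>i\<in>{1..s}. X i) f k =
    (\<Sum>i\<in>{1..s}. real (card (X i)) / real (card (\<Union>i\<in>{1..s}. X i)) *
                  iteration_entropy (X i) (F i) k)"
proof -
  let ?U = "\<Union>i\<in>{1..s}. X i"
  let ?S = "\<lambda>i. \<Sum>x\<in>X i. \<Sum>y\<in>X i. entropy_term (F i) k x y"
  have finU: "finite ?U"
    using assms(2) by blast
  have "(\<Sum>x\<in>?U. \<Sum>y\<in>?U. entropy_term f k x y)
      = (\<Sum>i\<in>{1..s}. \<Sum>x\<in>X i. \<Sum>y\<in>?U. entropy_term f k x y)"
    \<comment> \<open>Disjointness splits only the sum over starting points; the targets still range
      over the whole union until the next step.\<close>
    using assms(2,4) by (intro sum.UNION_disjoint) (auto simp: disjoint_family_on_def)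
  also have "\<dots> = (\<Sum>i\<in>{1..s}. ?S i)"
    using finU assms(5,6) by (intro sum.cong refl entropy_term_row_sum) auto
  finally have split: "(\<Sum>x\<in>?U. \<Sum>y\<in>?U. entropy_term f k x y) = (\<Sum>i\<in>{1..s}. ?S i)" .
  have "1 / (real k * real (card ?U)) * ?S i
      = real (card (X i)) / real (card ?U) * iteration_entropy (X i) (F i) k"
    if "i \<in> {1..s}" for i
  proof -
    \<comment> \<open>This lets the weight cancel the factor 1 / \<open>card (X i)\<close> in the
      entropy of \<open>F i\<close>.\<close>
    have "card (X i) \<noteq> 0"
      using assms(2,3) that by simp
    then show ?thesis
      by (simp add: iteration_entropy_eq)
  qed
  then show ?thesis
    \<comment> \<open>Instantiating at \<open>?U\<close> expands the left side and keeps the block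
      entropies folded, so the summands can be compared blockwise.\<close>
    unfolding iteration_entropy_eq[of ?U] split sum_distrib_left by (intro sum.cong refl)
qed

end
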